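(* Suppose that either (a) there exists a universally null set in $2^{\mathbb N}$ of cardinality $2^{\aleph_0}$, or (b) $2^{\aleph_0}\leq\aleph_2$. Then there is a universally null set in $2^{\mathbb N}$ which is not countably perfectly null in $2^{\mathbb N}$.
   Context: $2^{\mathbb N}$ is the Cantor space with the usual product topology. For a perfect Polish space $X$ (a Polish space without isolated points), a finite, non-atomic, Borel measure on $X$ is a countably additive measure $\mu$ defined on the $\sigma$-algebra of Borel subsets of $X$, with values in $[0,+\infty)$, vanishing on singletons. A set $A\subseteq X$ is universally null if $A$ has outer $\mu$-measure zero for every finite, non-atomic, Borel measure $\mu$ on $X$. A set $A\subseteq X$ is countably perfectly null in $X$ if for every finite, non-atomic, Borel measure $\mu$ on $X$ there is an $F_\sigma$-set $F$ in $X$ with $A\subseteq F$ and $\mu(F)=0$. *)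

theory Defs
  imports "HOL-Analysis.Analysis"
begin

unbundle cardinal_syntax

text \<open>
  The definitions below are intended for perfect Polish spaces, the carrier being the whole type.
  They need neither separability nor metrizability, only that points are closed: then singletons
  are Borel, so that the condition on them is not vacuous. \<^const>\<open>fsigma\<close> sets are always Borel.
\<close>

definition finite_nonatomic_borel_measure :: "'a::topological_space measure \<Rightarrow> bool" where
  "finite_nonatomic_borel_measure M \<longleftrightarrow>
     sets M = sets borel \<and> finite_measure M \<and> (\<forall>x. emeasure M {x} = 0)"

definition universally_null :: "'a::topological_space set \<Rightarrow> bool" where
  "universally_null A \<longleftrightarrow>
     (\<forall>M. finite_nonatomic_borel_measure M \<longrightarrow> outer_measure_of M A = 0)"

definition countably_perfectly_null :: "'a::topological_space set \<Rightarrow> bool" where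
  "countably_perfectly_null A \<longleftrightarrow>
     (\<forall>M. finite_nonatomic_borel_measure M \<longrightarrow>
        (\<exists>F. fsigma F \<and> A \<subseteq> F \<and> emeasure M F = 0))"

text \<open>
  The Cantor space is the type \<^typ>\<open>nat \<Rightarrow> bool\<close>: \<^typ>\<open>bool\<close> is discrete, and function types
  carry the product topology.
\<close>

type_synonym cantor = "nat \<Rightarrow> bool"

definition continuum :: "(nat \<Rightarrow> bool) rel" where
  "continuum = ctwo ^c natLeq"

definition aleph2 :: "nat set set rel" where
  "aleph2 = cardSuc (cardSuc natLeq)"

end

theory Submission
  imports Defs "HOL-Probability.Probability_Mass_Function"
begin

text \<open>
  Split the Cantor space into pairs \<open>(z, t)\<close> by interleaving and take the product of a nonatomic measure in \<open>z\<close>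
  with an atomic measure that charges every finitely supported \<open>t\<close>. For a null \<^term>\<open>fsigma\<close> set \<open>F\<close>
  almost every section in \<open>t\<close> avoids all finitely supported sequences, so it is \<open>\<sigma>\<close>-compact in the
  space of infinite subsets of the natural numbers and hence bounded for eventual dominance.

  Under (a), attach to each point \<open>a\<close> of the given universally null set an infinite set of codes of initial
  segments of \<open>a\<close>, so sparse that the resulting point escapes the \<open>a\<close>-th \<^term>\<open>fsigma\<close> set. Decoding
  maps the new set injectively onto the old one, so it is universally null.

  Under (b), suppose that (a) fails. If all sets smaller than the continuum were universally null, codes of
  null \<open>G\<^sub>\<delta>\<close> sets covering the initial segments of a well-order of the Cantor space would give (a) by
  Fubini (Grzegorek). If all families smaller than the continuum were bounded, a chain for eventual
  dominance of length continuum would give (a), since sets that are well-ordered by a Borel relation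
  are universally null (Reclaw). So there are a non-null set \<open>Z\<close> and an unbounded family, both of size at most
  \<open>\<aleph>\<^sub>1\<close>, and the pairs \<open>(z\<^sub>j, f\<^sub>i)\<close> with \<open>j \<le> i < \<omega>\<^sub>1\<close>, for an unbounded chain \<open>f\<close>, form the required set.
\<close>

section \<open>Sets of outer measure zero\<close>

text \<open>Provides sequence spaces over \<open>bool\<close> with a countable base, on which
  coordinatewise Borel measurability and the coding of F-sigma sets rest.\<close>

instance bool :: second_countable_topology
proof
  have "open = generate_topology (UNIV :: bool set set)"
    by (intro ext) (simp add: discrete_topology_class.open_discrete generate_topology.Basis)
  then show "\<exists>B::bool set set. countable B \<and> open = generate_topology B"
    by (intro exI[of _ UNIV]) (simp add: countable_finite)
qed

lemma measurable_discrete: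
  "measurable M (borel :: 'a::{countable,discrete_topology} measure) = measurable M (count_space UNIV)"
  by (rule measurable_cong_sets) (auto simp: borel_def discrete_topology_class.open_discrete sigma_sets.Basic)

lemma measurable_coord[measurable]:
  "(\<lambda>x. x n) \<in> measurable (borel :: ('i::countable \<Rightarrow> 'a::{countable,discrete_topology}) measure) (count_space UNIV)"
proof -
  have "(\<lambda>x::'i \<Rightarrow> 'a. x n) \<in> borel_measurable borel"
    by (intro borel_measurable_continuous_onI continuous_on_product_coordinates)
  then show ?thesis by (simp add: measurable_discrete)
qed

lemma singleton_in_sets_borel: "{x} \<in> sets (borel :: ('i::countable \<Rightarrow> 'a::{countable,discrete_topology}) measure)"
proof -
  have "{x} = (\<Inter>i. {y\<in>space borel. y i = x i})" by auto
  also have "\<dots> \<in> sets borel" by measurable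
  finally show ?thesis .
qed

lemma outer_null_iff:
  assumes "A \<subseteq> space M"
  shows "outer_measure_of M A = 0 \<longleftrightarrow> (\<exists>N\<in>null_sets M. A \<subseteq> N)"
proof
  assume "outer_measure_of M A = 0"
  then show "\<exists>N\<in>null_sets M. A \<subseteq> N"
    using outer_measure_of_attain[OF assms] by (metis null_setsI)
next
  assume "\<exists>N\<in>null_sets M. A \<subseteq> N"
  then show "outer_measure_of M A = 0"
    by (metis le_zero_eq null_setsD1 null_setsD2 outer_measure_of_eq outer_measure_of_mono)
qed

lemma outer_null_UN:
  assumes "countable I" "\<And>i. i \<in> I \<Longrightarrow> A i \<subseteq> space M" "\<And>i. i \<in> I \<Longrightarrow> outer_measure_of M (A i) = 0"
  shows "outer_measure_of M (\<Union>i\<in>I. A i) = 0"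
proof -
  have "\<forall>i\<in>I. \<exists>N\<in>null_sets M. A i \<subseteq> N" using assms outer_null_iff by metis
  then obtain N where N: "\<And>i. i \<in> I \<Longrightarrow> N i \<in> null_sets M \<and> A i \<subseteq> N i" by metis
  then have "(\<Union>i\<in>I. N i) \<in> null_sets M" "(\<Union>i\<in>I. A i) \<subseteq> (\<Union>i\<in>I. N i)"
    using assms(1) by (auto intro: null_sets_UN')
  moreover have "(\<Union>i\<in>I. A i) \<subseteq> space M" using assms by auto
  ultimately show ?thesis using outer_null_iff by blast
qed

lemma outer_null_Un:
  assumes "A \<union> B \<subseteq> space M" "outer_measure_of M A = 0" "outer_measure_of M B = 0"
  shows "outer_measure_of M (A \<union> B) = 0"
  using outer_null_UN[of "{A, B}" "\<lambda>x. x" M] assms by auto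

lemma outer_null_subset: "A \<subseteq> B \<Longrightarrow> outer_measure_of M B = 0 \<Longrightarrow> outer_measure_of M A = 0"
  by (metis le_zero_eq outer_measure_of_mono)

text \<open>A one-sided Fubini theorem for a set \<open>X\<close> that may be nonmeasurable:
  \<open>X\<close> is enlarged to the measurable set \<open>B\<close> of all points with null
  section, and Tonelli is applied to \<open>R\<close> restricted to \<open>B\<close>.\<close>

lemma AE_null_sections:
  assumes "sigma_finite_measure \<nu>" "sigma_finite_measure \<rho>"
    and R: "R \<in> sets (\<nu> \<Otimes>\<^sub>M \<rho>)"
    and X: "X \<subseteq> space \<nu>" "\<And>x. x \<in> X \<Longrightarrow> emeasure \<rho> (Pair x -` R) = 0"
  shows "AE z in \<rho>. outer_measure_of \<nu> {x \<in> X. (x, z) \<in> R} = 0"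
proof -
  interpret \<nu>: sigma_finite_measure \<nu> by fact
  interpret \<rho>: sigma_finite_measure \<rho> by fact
  interpret pair_sigma_finite \<nu> \<rho> ..
  define B where "B = {x\<in>space \<nu>. emeasure \<rho> (Pair x -` R) = 0}"
  have [measurable]: "R \<in> sets (\<nu> \<Otimes>\<^sub>M \<rho>)" by fact
  have [measurable]: "(\<lambda>x. emeasure \<rho> (Pair x -` R)) \<in> borel_measurable \<nu>"
    using R by (rule \<rho>.measurable_emeasure_Pair)
  have B[measurable]: "B \<in> sets \<nu>" unfolding B_def by measurable
  define S where "S = R \<inter> (B \<times> space \<rho>)"
  have S[measurable]: "S \<in> sets (\<nu> \<Otimes>\<^sub>M \<rho>)" unfolding S_def by measurable
  have "emeasure \<rho> (Pair x -` S) = 0" if "x \<in> space \<nu>" for x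
  proof (cases "x \<in> B")
    case True
    then have "Pair x -` S \<subseteq> Pair x -` R" by (auto simp: S_def)
    moreover have "Pair x -` R \<in> sets \<rho>" using R by (rule sets_Pair1)
    ultimately show ?thesis
      using True by (metis (mono_tags, lifting) B_def emeasure_mono le_zero_eq mem_Collect_eq)
  next
    case False
    then have "Pair x -` S = {}" by (auto simp: S_def)
    then show ?thesis by simp
  qed
  then have "emeasure (\<nu> \<Otimes>\<^sub>M \<rho>) S = 0"
    by (simp add: \<rho>.emeasure_pair_measure_alt[OF S] cong: nn_integral_cong)
  then have "(\<integral>\<^sup>+ z. emeasure \<nu> ((\<lambda>x. (x, z)) -` S) \<partial>\<rho>) = 0"
    by (simp add: emeasure_pair_measure_alt2[OF S])
  then have "AE z in \<rho>. emeasure \<nu> ((\<lambda>x. (x, z)) -` S) = 0"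
    by (subst (asm) nn_integral_0_iff_AE) (use S in \<open>auto intro: measurable_emeasure_Pair2\<close>)
  then show ?thesis
  proof eventually_elim
    case (elim z)
    have *: "(\<lambda>x. (x, z)) -` S \<in> null_sets \<nu>" using elim sets_Pair2[OF S] by (intro null_setsI)
    have "{x \<in> X. (x, z) \<in> R} \<subseteq> (\<lambda>x. (x, z)) -` S"
      using X sets.sets_into_space[OF R] by (auto simp: S_def B_def space_pair_measure)
    then show ?case using * X outer_null_iff[of "{x \<in> X. (x, z) \<in> R}" \<nu>] by blast
  qed
qed

section \<open>Universally null sets\<close>

lemma finite_nonatomic_borel_measureD:
  assumes "finite_nonatomic_borel_measure M"
  shows "finite_measure M" "sets M = sets borel" "space M = UNIV" "emeasure M {x} = 0"
  using assms sets_eq_imp_space_eq[of M borel] by (auto simp: finite_nonatomic_borel_measure_def)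

lemma countable_outer_null:
  fixes X :: "('i::countable \<Rightarrow> 'a::{countable,discrete_topology}) set"
  assumes "finite_nonatomic_borel_measure M" "countable X"
  shows "outer_measure_of M X = 0"
proof -
  have "outer_measure_of M (\<Union>x\<in>X. {x}) = 0"
    using finite_nonatomic_borel_measureD[OF assms(1)] assms(2)
    by (intro outer_null_UN) (auto simp: singleton_in_sets_borel)
  then show ?thesis by simp
qed

text \<open>The image of a nonatomic measure may have atoms, but only countably many; the rest of the image
  measure is nonatomic, and the part of \<^term>\<open>X\<close> lying over the atoms is countable.\<close>

lemma universally_null_vimage:
  fixes X :: "('i::countable \<Rightarrow> 'a::{countable,discrete_topology}) set"
    and f :: "_ \<Rightarrow> 'j::countable \<Rightarrow> 'b::{countable,discrete_topology}"
  assumes f[measurable]: "f \<in> borel_measurable borel"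
    and UN: "universally_null (f ` X)"
    and fib: "\<And>y. countable {x\<in>X. f x = y}"
  shows "universally_null X"
  unfolding universally_null_def
proof (intro allI impI)
  fix M :: "('i \<Rightarrow> 'a) measure" assume M: "finite_nonatomic_borel_measure M"
  note MD = finite_nonatomic_borel_measureD[OF M]
  interpret finite_measure M by (rule MD)
  have [measurable_cong]: "sets M = sets borel" by (rule MD)
  define D where "D = distr M borel f"
  interpret D: finite_measure D unfolding D_def by (rule finite_measure_distr) simp
  define At where "At = {y. measure D {y} \<noteq> 0}"
  have At: "countable At" unfolding At_def by (rule D.countable_support)
  have sB: "S \<in> sets borel" if "countable S" for S :: "('j \<Rightarrow> 'b) set"
    using that singleton_in_sets_borel by (rule sets.countable[rotated])
  have [measurable]: "At \<in> sets borel" using At by (rule sB)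
  define N where "N = density D (indicator (- At))"
  have emN: "emeasure N S = emeasure D (S - At)" if "S \<in> sets borel" for S
    using that unfolding N_def by (subst emeasure_density) (auto simp: D_def Diff_eq indicator_inter_arith[symmetric] ac_simps)
  have "finite_nonatomic_borel_measure N"
    unfolding finite_nonatomic_borel_measure_def
  proof (intro conjI allI)
    show "sets N = sets borel" by (simp add: N_def D_def)
    have "space N = UNIV" by (simp add: N_def D_def)
    then show "finite_measure N"
      using D.emeasure_finite[of "UNIV - At"] by (intro finite_measureI) (simp add: emN)
    fix y
    have "{y} - At = (if y \<in> At then {} else {y})" by auto
    then show "emeasure N {y} = 0"
      using singleton_in_sets_borel[of y] by (simp add: emN D.emeasure_eq_measure) (simp add: At_def)
  qed
  then have "outer_measure_of N (f ` X) = 0" using UN by (simp add: universally_null_def)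
  then obtain S where S: "S \<in> null_sets N" "f ` X \<subseteq> S"
    using outer_null_iff[of "f ` X" N] by (auto simp: N_def D_def)
  then have [measurable]: "S \<in> sets borel" by (auto simp: N_def D_def dest: null_setsD2)
  then have "emeasure D (S - At) = 0" using null_setsD1[OF S(1)] by (simp add: emN)
  then have "f -` (S - At) \<in> null_sets M"
    using measurable_sets[OF f, of "S - At"] by (intro null_setsI) (auto simp: D_def emeasure_distr MD)
  then have 1: "outer_measure_of M {x\<in>X. f x \<notin> At} = 0"
    using S(2) by (subst outer_null_iff) (auto simp: MD intro!: bexI[of _ "f -` (S - At)"])
  have "{x\<in>X. f x \<in> At} = (\<Union>y\<in>At. {x\<in>X. f x = y})" by auto
  then have 2: "outer_measure_of M {x\<in>X. f x \<in> At} = 0"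
    using At fib by (intro countable_outer_null[OF M]) simp
  have "X = {x\<in>X. f x \<notin> At} \<union> {x\<in>X. f x \<in> At}" by auto
  then show "outer_measure_of M X = 0" using outer_null_Un[OF _ 1 2] by (simp add: MD)
qed

text \<open>By Fubini for \<open>M\<close> and its restriction to a measurable envelope of
  \<open>X\<close>, almost every \<open>z\<close> has a null set of \<open>R\<close>-successors in
  \<open>X\<close>. If such a \<open>z\<close> lies in \<open>X\<close>, totality splits
  \<open>X\<close> into the predecessors of \<open>z\<close>, its successors and \<open>z\<close>
  itself, all null. Otherwise \<open>X\<close> is contained in the exceptional set.\<close>

lemma outer_null_if_initial_segments_null:
  fixes X :: "('i::countable \<Rightarrow> 'a::{countable,discrete_topology}) set"
  assumes M: "finite_nonatomic_borel_measure M"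
    and R: "R \<in> sets (borel \<Otimes>\<^sub>M borel)"
    and tot: "total_on X R"
    and null: "\<And>x. x \<in> X \<Longrightarrow> outer_measure_of M {y\<in>X. (y, x) \<in> R} = 0"
  shows "outer_measure_of M X = 0"
proof -
  note MD = finite_nonatomic_borel_measureD[OF M]
  interpret finite_measure M by (rule MD)
  have [measurable_cong]: "sets M = sets borel" by (rule MD)
  obtain E where "E \<in> sets M" "X \<subseteq> E" "outer_measure_of M X = emeasure M E"
    using outer_measure_of_attain[of X M] by (auto simp: MD)
  then have env: "measurable_envelope M X E"
    by (subst measurable_envelope_eq2) (auto simp: less_top[symmetric])
  note E = measurable_envelopeD[OF env]
  \<comment> \<open>On Borel sets this measure equals the outer measure of the trace on
    \<open>X\<close>, so hypotheses about subsets of \<open>X\<close> become statements about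
    \<open>\<rho>\<close>.\<close>
  define \<rho> where "\<rho> = density M (indicator E)"
  have sets_\<rho>[measurable_cong]: "sets \<rho> = sets borel" by (simp add: \<rho>_def MD)
  have [measurable]: "E \<in> sets M" by (rule E)
  have em\<rho>: "emeasure \<rho> S = outer_measure_of M (S \<inter> X)" if "S \<in> sets borel" for S
    using that E(3)[of S] unfolding \<rho>_def
    by (subst emeasure_density) (auto simp: MD indicator_inter_arith[symmetric] ac_simps)
  have space_\<rho>: "space \<rho> = UNIV" by (simp add: \<rho>_def MD)
  have "finite_measure \<rho>"
    by (rule finite_measureI) (simp add: em\<rho> space_\<rho> measurable_envelopeD2[OF env, symmetric])
  then interpret \<rho>: finite_measure \<rho> .
  define R' where "R' = (\<lambda>(x, y). (y, x)) -` R"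
  have R': "R' \<in> sets (M \<Otimes>\<^sub>M \<rho>)"
  proof -
    have "R' = (\<lambda>(x, y). (y, x)) -` R \<inter> space (M \<Otimes>\<^sub>M \<rho>)"
      by (auto simp: R'_def space_pair_measure MD space_\<rho>)
    also have "\<dots> \<in> sets (M \<Otimes>\<^sub>M \<rho>)"
      by (rule measurable_sets[OF _ R]) measurable
    finally show ?thesis .
  qed
  have "AE z in \<rho>. outer_measure_of M {x \<in> X. (x, z) \<in> R'} = 0"
  proof (rule AE_null_sections[OF _ _ R'])
    show "emeasure \<rho> (Pair x -` R') = 0" if "x \<in> X" for x
    proof -
      have "Pair x -` R' \<inter> X = {y\<in>X. (y, x) \<in> R}" by (auto simp: R'_def)
      moreover have "Pair x -` R' \<in> sets borel" using sets_Pair1[OF R', of x] by (simp add: sets_\<rho>)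
      ultimately show ?thesis using null[OF that] by (simp add: em\<rho>)
    qed
  qed (auto simp: MD sigma_finite_measure_axioms \<rho>.sigma_finite_measure_axioms)
  then obtain N where N: "N \<in> null_sets \<rho>"
      "\<And>z. z \<notin> N \<Longrightarrow> outer_measure_of M {x \<in> X. (x, z) \<in> R'} = 0"
    by (rule AE_E3) (auto simp: space_\<rho>)
  have NX: "outer_measure_of M (N \<inter> X) = 0"
    using null_setsD1[OF N(1)] null_setsD2[OF N(1)] em\<rho>[of N] by (simp add: sets_\<rho>)
  show ?thesis
  proof (cases "X \<subseteq> N")
    case True
    then have "N \<inter> X = X" by auto
    with NX show ?thesis by simp
  next
    case False
    then obtain z where z: "z \<in> X" "z \<notin> N" by auto
    then have 1: "outer_measure_of M {x \<in> X. (z, x) \<in> R} = 0" using N(2)[of z] by (simp add: R'_def)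
    have "X = ({x \<in> X. (z, x) \<in> R} \<union> {x\<in>X. (x, z) \<in> R}) \<union> {z}"
      using tot z by (auto simp: total_on_def)
    moreover have "outer_measure_of M \<dots> = 0"
      using 1 null[OF z(1)] countable_outer_null[OF M, of "{z}"] by (intro outer_null_Un) (auto simp: MD)
    ultimately show ?thesis by simp
  qed
qed

text \<open>Well-founded induction: an initial segment has null initial segments by the induction
  hypothesis, so it is null by the preceding lemma. A last application of that lemma handles
  \<open>X\<close>.\<close>

theorem universally_null_if_Borel_well_ordered:
  fixes X :: "('i::countable \<Rightarrow> 'a::{countable,discrete_topology}) set"
  assumes R: "R \<in> sets (borel \<Otimes>\<^sub>M borel)"
    and tot: "total_on X R" and wf: "wf (R \<inter> X \<times> X)"
  shows "universally_null X"
  unfolding universally_null_def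
proof (intro allI impI)
  fix M :: "('i \<Rightarrow> 'a) measure" assume M: "finite_nonatomic_borel_measure M"
  have "x \<in> X \<longrightarrow> outer_measure_of M {y\<in>X. (y, x) \<in> R} = 0" for x
  proof (induction x rule: wf_induct_rule[OF wf])
    case (1 x)
    show ?case
    proof (rule impI, rule outer_null_if_initial_segments_null[OF M R])
      assume "x \<in> X"
      show "total_on {y \<in> X. (y, x) \<in> R} R" using tot by (auto simp: total_on_def)
      fix w assume "w \<in> {y \<in> X. (y, x) \<in> R}"
      then have "outer_measure_of M {y \<in> X. (y, w) \<in> R} = 0" using 1 \<open>x \<in> X\<close> by auto
      then show "outer_measure_of M {y \<in> {y \<in> X. (y, x) \<in> R}. (y, w) \<in> R} = 0"
        by (rule outer_null_subset[rotated]) auto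
    qed
  qed
  then show "outer_measure_of M X = 0"
    using outer_null_if_initial_segments_null[OF M R tot] by blast
qed

section \<open>A measure with bounded null sections\<close>

definition interleave :: "cantor \<Rightarrow> cantor \<Rightarrow> cantor" where
  "interleave z t n = (if even n then z (n div 2) else t (n div 2))"

definition evens :: "cantor \<Rightarrow> cantor" where "evens y n = y (2 * n)"

definition odds :: "cantor \<Rightarrow> cantor" where "odds y n = y (2 * n + 1)"

lemma evens_interleave[simp]: "evens (interleave z t) = z"
  and odds_interleave[simp]: "odds (interleave z t) = t"
  by (auto simp: fun_eq_iff interleave_def evens_def odds_def)

lemma measurable_into_sequencesI:
  assumes "\<And>n::nat. (\<lambda>x. f x n :: 'a::{countable,discrete_topology,second_countable_topology}) \<in> measurable M (count_space UNIV)"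
  shows "f \<in> borel_measurable M"
  using assms by (intro measurable_coordinatewise_then_product) (simp add: measurable_discrete)

lemma evens_measurable[measurable]: "evens \<in> borel_measurable borel"
  unfolding evens_def[abs_def] by (intro measurable_into_sequencesI) measurable

lemma odds_measurable[measurable]: "odds \<in> borel_measurable borel"
  unfolding odds_def[abs_def] by (intro measurable_into_sequencesI) measurable

lemma interleave_measurable[measurable]:
  assumes [measurable]: "f \<in> borel_measurable M" "g \<in> borel_measurable M"
  shows "(\<lambda>x. interleave (f x) (g x)) \<in> borel_measurable M"
  unfolding interleave_def[abs_def]
  by (intro measurable_into_sequencesI measurable_If)
    (auto intro!: measurable_compose[OF _ measurable_coord] assms)

lemma continuous_interleave: "continuous_on UNIV (interleave z)"
proof (rule continuous_on_coordinatewise_then_product)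
  show "continuous_on UNIV (\<lambda>t. interleave z t n)" for n
    by (cases "even n") (auto simp: interleave_def intro: continuous_on_product_coordinates)
qed

lemma fsigma_vimage:
  assumes "fsigma F" "continuous_on UNIV f"
  shows "fsigma (f -` F)"
proof -
  obtain C where C: "F = (\<Union>n::nat. C n)" "\<And>n. closed (C n)"
    using assms(1) by (auto elim!: fsigma.cases)
  have "f -` F = (\<Union>n. f -` C n)" using C by auto
  moreover have "closed (f -` C n)" for n
    using assms(2) C(2) continuous_on_closed_vimage[of UNIV f] by auto
  ultimately show ?thesis using fsigma.intros by metis
qed

lemma fsigma_borel: "fsigma F \<Longrightarrow> F \<in> sets borel"
  by (auto elim!: fsigma.cases)

text \<open>Enumerates, with repetitions, the finitely supported sequences: each list is continued
  by \<open>False\<close>. As subsets of the naturals these are the finite sets.\<close>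

definition finseq :: "nat \<Rightarrow> cantor" where
  "finseq n i \<longleftrightarrow> i < length (from_nat n :: bool list) \<and> (from_nat n :: bool list) ! i"

lemma open_cantor_cylinder:
  fixes U :: "cantor set"
  assumes "open U" "q \<in> U"
  shows "\<exists>j. \<forall>t. (\<forall>m<j. t m = q m) \<longrightarrow> t \<in> U"
proof -
  obtain X where X: "q \<in> Pi\<^sub>E UNIV X" "finite {i. X i \<noteq> UNIV}" "Pi\<^sub>E UNIV X \<subseteq> U"
    using product_topology_open_contains_basis[of "\<lambda>_. euclidean" UNIV U q] assms
    by (auto simp: open_fun_def)
  obtain j where j: "\<And>i. X i \<noteq> UNIV \<Longrightarrow> i < j"
    using X(2) finite_nat_set_iff_bounded by auto
  have "t \<in> U" if "\<forall>m<j. t m = q m" for t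
  proof -
    have "t i \<in> X i" for i using X(1) j[of i] that by (cases "X i = UNIV") (auto simp: PiE_iff)
    then show ?thesis using X(3) by (auto simp: PiE_iff)
  qed
  then show ?thesis by blast
qed

text \<open>Let \<open>t\<close> lie in the closed piece \<open>C n\<close>. Some cylinder around
  the first \<open>k\<close> values of \<open>t\<close>, padded by \<open>False\<close>, misses
  \<open>C n\<close>, so \<open>t\<close> differs from the padded word within the length of that
  cylinder. They agree below \<open>k\<close>, so \<open>t\<close> has a true entry from
  \<open>k\<close> on.\<close>

lemma fsigma_avoiding_finseq_bounded:
  assumes "fsigma E" and avoid: "\<And>n. finseq n \<notin> E"
  shows "\<exists>\<phi>. \<forall>t\<in>E. \<forall>\<^sub>F k in sequentially. \<exists>m\<in>{k..<\<phi> k}. t m"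
proof -
  obtain C where C: "E = (\<Union>n::nat. C n)" "\<And>n. closed (C n)"
    using assms(1) by (auto elim!: fsigma.cases)
  have "\<exists>j. \<forall>t\<in>C n. \<exists>m<j. t m \<noteq> finseq i m" for n i
  proof -
    have "open (- C n)" "finseq i \<in> - C n" using C avoid by auto
    then obtain j where "\<forall>t. (\<forall>m<j. t m = finseq i m) \<longrightarrow> t \<in> - C n" using open_cantor_cylinder by blast
    then show ?thesis by (intro exI[of _ j]) auto
  qed
  then obtain J where J: "\<And>n i t. t \<in> C n \<Longrightarrow> \<exists>m<J n i. t m \<noteq> finseq i m" by metis
  define Q where "Q k = (\<lambda>s. to_nat s) ` {s::bool list. length s = k}" for k
  have fQ: "finite (Q k)" for k
    using finite_lists_length_eq[of "UNIV::bool set" k] by (simp add: Q_def)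
  \<comment> \<open>Only finitely many words have length \<open>k\<close>, so a maximum over these
    words and the pieces \<open>C 0\<close> to \<open>C k\<close> exists; \<open>C n\<close> is
    served as soon as \<open>k \<ge> n\<close>.\<close>
  define \<phi> where "\<phi> k = Max (insert 0 ((\<lambda>(n, i). J n i) ` ({..k} \<times> Q k)))" for k
  have "\<exists>m\<in>{k..<\<phi> k}. t m" if "t \<in> C n" "n \<le> k" for t n k
  proof -
    define i where "i = to_nat (map t [0..<k])"
    obtain m where m: "m < J n i" "t m \<noteq> finseq i m" using J \<open>t \<in> C n\<close> by blast
    have "J n i \<le> \<phi> k"
      unfolding \<phi>_def using fQ[of k] that by (intro Max_ge) (auto simp: Q_def i_def)
    moreover have "finseq i m = (m < k \<and> t m)" by (auto simp: finseq_def i_def)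
    ultimately show ?thesis using m by (intro bexI[of _ m]) auto
  qed
  then have "\<forall>t\<in>E. \<exists>n. \<forall>k\<ge>n. \<exists>m\<in>{k..<\<phi> k}. t m" using C(1) by blast
  then show ?thesis unfolding eventually_sequentially by blast
qed

text \<open>\<open>M\<close> is the image of a product measure under interleaving with
  \<open>finseq\<close>. It has no atoms, since all pairs over one point share their first
  coordinate. For a null F-sigma set, Fubini leaves almost every section free of all
  \<open>finseq n\<close>, hence bounded.\<close>

lemma exists_measure_bounding_sections:
  assumes "finite_nonatomic_borel_measure \<rho>"
  shows "\<exists>M. finite_nonatomic_borel_measure M \<and> (\<forall>F. fsigma F \<longrightarrow> emeasure M F = 0 \<longrightarrow>
    (AE z in \<rho>. \<exists>\<phi>. \<forall>t. interleave z t \<in> F \<longrightarrow> (\<forall>\<^sub>F k in sequentially. \<exists>m\<in>{k..<\<phi> k}. t m)))"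
proof -
  have \<rho>: "finite_measure \<rho>" "sets \<rho> = sets borel" "\<And>x. emeasure \<rho> {x} = 0"
    using assms by (auto simp: finite_nonatomic_borel_measure_def)
  have space_\<rho>: "space \<rho> = UNIV" using sets_eq_imp_space_eq[OF \<rho>(2)] by simp
  have [measurable_cong]: "sets \<rho> = sets borel" by fact
  interpret \<rho>: finite_measure \<rho> by fact
  \<comment> \<open>Any distribution charging every natural number would do: full support turns
    "almost every \<open>n\<close>" into "every \<open>n\<close>".\<close>
  define p where "p = geometric_pmf (1/2)"
  have p: "set_pmf p = UNIV" unfolding p_def by (rule set_pmf_geometric) auto
  interpret P: pair_sigma_finite \<rho> "measure_pmf p" ..
  interpret P: finite_measure "\<rho> \<Otimes>\<^sub>M measure_pmf p"
    by (intro finite_measure_pair_measure \<rho>) (rule measure_pmf.finite_measure_axioms)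
  define h where "h = (\<lambda>(z, n). interleave z (finseq n))"
  have h[measurable]: "h \<in> borel_measurable (\<rho> \<Otimes>\<^sub>M measure_pmf p)"
    unfolding h_def by measurable
  define M where "M = distr (\<rho> \<Otimes>\<^sub>M measure_pmf p) borel h"
  have emM: "emeasure M S = emeasure (\<rho> \<Otimes>\<^sub>M measure_pmf p) (h -` S)" if "S \<in> sets borel" for S
    using that unfolding M_def by (subst emeasure_distr) (auto simp: space_pair_measure space_\<rho>)
  have "finite_nonatomic_borel_measure M"
    unfolding finite_nonatomic_borel_measure_def
  proof (intro conjI allI)
    show "sets M = sets borel" by (simp add: M_def)
    show "finite_measure M" unfolding M_def by (rule P.finite_measure_distr) simp
    fix y
    have "h -` {y} \<subseteq> {evens y} \<times> UNIV" by (auto simp: h_def)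
    then have "emeasure (\<rho> \<Otimes>\<^sub>M measure_pmf p) (h -` {y}) \<le> emeasure (\<rho> \<Otimes>\<^sub>M measure_pmf p) ({evens y} \<times> UNIV)"
      by (intro emeasure_mono pair_measureI) (auto simp: \<rho> singleton_in_sets_borel)
    also have "\<dots> = 0"
      by (subst measure_pmf.emeasure_pair_measure_Times) (auto simp: \<rho> singleton_in_sets_borel)
    finally show "emeasure M {y} = 0" by (simp add: emM singleton_in_sets_borel)
  qed
  moreover have "AE z in \<rho>. \<exists>\<phi>. \<forall>t. interleave z t \<in> F \<longrightarrow> (\<forall>\<^sub>F k in sequentially. \<exists>m\<in>{k..<\<phi> k}. t m)"
    if F: "fsigma F" "emeasure M F = 0" for F
  proof -
    have [measurable]: "F \<in> sets borel" using F(1) by (rule fsigma_borel)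
    have "h -` F \<inter> space (\<rho> \<Otimes>\<^sub>M measure_pmf p) \<in> sets (\<rho> \<Otimes>\<^sub>M measure_pmf p)" by measurable
    then have "h -` F \<in> null_sets (\<rho> \<Otimes>\<^sub>M measure_pmf p)"
      using F(2) emM[of F] by (intro null_setsI) (auto simp: space_pair_measure space_\<rho>)
    then have "AE x in \<rho> \<Otimes>\<^sub>M measure_pmf p. h x \<notin> F" by (auto dest: AE_not_in)
    then have "AE z in \<rho>. AE n in measure_pmf p. h (z, n) \<notin> F" by (rule P.AE_pair)
    then show ?thesis
    proof eventually_elim
      case (elim z)
      have "fsigma (interleave z -` F)" by (rule fsigma_vimage[OF F(1) continuous_interleave])
      moreover have "finseq n \<notin> interleave z -` F" for n using elim p by (auto simp: AE_measure_pmf_iff h_def)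
      ultimately show ?case using fsigma_avoiding_finseq_bounded[of "interleave z -` F"] by auto
    qed
  qed
  ultimately show ?thesis by blast
qed

section \<open>Chains under eventual dominance\<close>

definition dom_lt :: "((nat \<Rightarrow> nat) \<times> (nat \<Rightarrow> nat)) set" where
  "dom_lt = {(f, g). \<forall>\<^sub>F n in sequentially. f n < g n}"

lemma dom_lt_measurable: "dom_lt \<in> sets (borel \<Otimes>\<^sub>M borel)"
proof -
  have [measurable]: "(\<lambda>x. (fst x :: nat \<Rightarrow> nat) n) \<in> measurable (borel \<Otimes>\<^sub>M borel) (count_space UNIV)" for n
    by (rule measurable_compose[OF measurable_fst measurable_coord])
  have [measurable]: "(\<lambda>x. (snd x :: nat \<Rightarrow> nat) n) \<in> measurable (borel \<Otimes>\<^sub>M borel) (count_space UNIV)" for n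
    by (rule measurable_compose[OF measurable_snd measurable_coord])
  have "dom_lt = {x \<in> space (borel \<Otimes>\<^sub>M borel). \<exists>N. \<forall>n\<ge>N. fst x n < snd x n}"
    by (simp add: dom_lt_def eventually_sequentially space_pair_measure set_eq_iff split_beta)
  also have "\<dots> \<in> sets (borel \<Otimes>\<^sub>M borel)" by measurable
  finally show ?thesis .
qed

lemma dom_lt_irrefl: "(f, f) \<notin> dom_lt"
  by (simp add: dom_lt_def)

lemma dom_lt_asym: "(f, g) \<in> dom_lt \<Longrightarrow> (g, f) \<notin> dom_lt"
proof
  assume "(f, g) \<in> dom_lt" "(g, f) \<in> dom_lt"
  then have "\<forall>\<^sub>F n in sequentially. f n < g n \<and> g n < f n" by (auto simp: dom_lt_def eventually_conj_iff)
  then have "\<forall>\<^sub>F n::nat in sequentially. False" by (rule eventually_mono) auto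
  then show False by simp
qed

lemma dom_chain_inj:
  assumes r: "Well_order r"
    and chain: "\<And>i j. (j, i) \<in> r \<Longrightarrow> j \<noteq> i \<Longrightarrow> (f j, f i) \<in> dom_lt"
  shows "inj_on f (Field r)"
proof (intro inj_onI, rule ccontr)
  fix i j assume ij: "i \<in> Field r" "j \<in> Field r" "f i = f j" "i \<noteq> j"
  then have "(i, j) \<in> r \<or> (j, i) \<in> r" using wo_rel.TOTALS[of r] r unfolding wo_rel_def by blast
  then show False using chain[of i j] chain[of j i] ij dom_lt_irrefl[of "f j"] by auto
qed

text \<open>On the chain, asymmetry of \<open>dom_lt\<close> forces it to agree with the strict
  index order, so the chain is well-ordered by a Borel relation.\<close>

lemma dom_chain_universally_null:
  assumes r: "Well_order r"
    and chain: "\<And>i j. (j, i) \<in> r \<Longrightarrow> j \<noteq> i \<Longrightarrow> (f j, f i) \<in> dom_lt"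
  shows "universally_null (f ` Field r)"
proof (rule universally_null_if_Borel_well_ordered[OF dom_lt_measurable])
  have tot: "i = j \<or> (i, j) \<in> r \<or> (j, i) \<in> r" if "i \<in> Field r" "j \<in> Field r" for i j
    using wo_rel.TOTALS[of r] r that unfolding wo_rel_def by blast
  then show "total_on (f ` Field r) dom_lt"
    unfolding total_on_def using chain by auto
  have inj: "inj_on f (Field r)" using dom_chain_inj[OF r] chain by blast
  have "dom_lt \<inter> f ` Field r \<times> f ` Field r \<subseteq> inv_image (r - Id) (inv_into (Field r) f)"
  proof clarify
    fix i j assume ij: "i \<in> Field r" "j \<in> Field r" "(f i, f j) \<in> dom_lt"
    then have "i \<noteq> j" "(j, i) \<notin> r" using chain dom_lt_asym dom_lt_irrefl by metis+
    then have "(i, j) \<in> r" using tot ij by metis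
    then show "(f i, f j) \<in> inv_image (r - Id) (inv_into (Field r) f)"
      using \<open>i \<noteq> j\<close> ij by (simp add: inv_into_f_f[OF inj])
  qed
  moreover have "wf (r - Id)" using r by (simp add: well_order_on_def)
  ultimately show "wf (dom_lt \<inter> f ` Field r \<times> f ` Field r)"
    by (meson wf_inv_image wf_subset)
qed

text \<open>Transfinite recursion, going at each stage above a bound for all earlier functions. The
  prescribed \<open>w\<close> lets the chain majorize a given family and so inherit its
  unboundedness.\<close>

lemma dom_chain_exists:
  fixes w :: "'i \<Rightarrow> nat \<Rightarrow> nat"
  assumes r: "Well_order r"
    and bnd: "\<And>i (h :: 'i \<Rightarrow> nat \<Rightarrow> nat). i \<in> Field r \<Longrightarrow>
      \<exists>g. \<forall>j\<in>underS r i. \<forall>\<^sub>F n in sequentially. h j n \<le> g n"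
  shows "\<exists>f. \<forall>i\<in>Field r. strict_mono (f i) \<and> (\<forall>n. w i n \<le> f i n) \<and>
    (\<forall>j. (j, i) \<in> r \<longrightarrow> j \<noteq> i \<longrightarrow> (f j, f i) \<in> dom_lt)"
proof -
  define P where "P f i g \<longleftrightarrow> (i \<in> Field r \<longrightarrow> strict_mono g \<and> (\<forall>n. w i n \<le> g n) \<and>
    (\<forall>j. (j, i) \<in> r \<longrightarrow> j \<noteq> i \<longrightarrow> (f j, g) \<in> dom_lt))" for f i g
  have "\<exists>f. \<forall>i. P f i (f i)"
  proof (rule dependent_wf_choice[of "r - Id"])
    show "wf (r - Id)" using r by (simp add: well_order_on_def)
    show "P f x g = P f' x g" if "\<And>z. (z, x) \<in> r - Id \<Longrightarrow> f z = f' z" for f f' g x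
      using that by (auto simp: P_def)
    fix i and f :: "'i \<Rightarrow> nat \<Rightarrow> nat"
    show "\<exists>g. P f i g"
    proof (cases "i \<in> Field r")
      case True
      obtain b where b: "\<forall>j\<in>underS r i. \<forall>\<^sub>F n in sequentially. f j n \<le> b n" using bnd[OF True] by blast
      \<comment> \<open>Partial sums force growth, and \<open>Suc\<close> makes both the growth and
        the dominance over \<open>b\<close> strict.\<close>
      define g where "g n = (\<Sum>m\<le>n. Suc (w i m + b m))" for n
      have ge: "Suc (w i n + b n) \<le> g n" for n
        unfolding g_def by (rule member_le_sum) auto
      have "strict_mono g" by (auto simp: strict_mono_Suc_iff g_def)
      moreover have "w i n \<le> g n" for n using ge[of n] by simp
      moreover have "(f j, g) \<in> dom_lt" if "(j, i) \<in> r" "j \<noteq> i" for j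
      proof -
        have "j \<in> underS r i" using that by (simp add: underS_def)
        then have "\<forall>\<^sub>F n in sequentially. f j n \<le> b n" using b by blast
        then have "\<forall>\<^sub>F n in sequentially. f j n < g n"
        proof (rule eventually_mono)
          show "f j n < g n" if "f j n \<le> b n" for n using that ge[of n] by linarith
        qed
        then show ?thesis by (simp add: dom_lt_def)
      qed
      ultimately show ?thesis unfolding P_def by blast
    qed (simp add: P_def)
  qed
  then show ?thesis unfolding P_def by blast
qed

lemma countable_family_bounded:
  fixes h :: "'i \<Rightarrow> nat \<Rightarrow> nat"
  assumes "countable J"
  shows "\<exists>g. \<forall>j\<in>J. \<forall>\<^sub>F n in sequentially. h j n \<le> g n"
proof (cases "J = {}")
  case False
  \<comment> \<open>At \<open>n\<close> only the first \<open>n + 1\<close> members count, so the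
    \<open>m\<close>-th member is bounded from \<open>m\<close> on.\<close>
  define g where "g n = (\<Sum>m\<le>n. h (from_nat_into J m) n)" for n
  have "\<forall>\<^sub>F n in sequentially. h j n \<le> g n" if j: "j \<in> J" for j
  proof -
    obtain m where m: "from_nat_into J m = j" using from_nat_into_surj[OF assms j] by blast
    have "h j n \<le> g n" if "n \<ge> m" for n
      unfolding g_def m[symmetric] using that member_le_sum[of m "{..n}" "\<lambda>m. h (from_nat_into J m) n"] by simp
    then show ?thesis unfolding eventually_sequentially by blast
  qed
  then show ?thesis by blast
qed simp

section \<open>Increasing functions coded as infinite subsets of the naturals\<close>

definition range_ind :: "(nat \<Rightarrow> nat) \<Rightarrow> cantor" where
  "range_ind f m \<longleftrightarrow> m \<in> range f"

text \<open>The increasing enumeration of the set coded by \<open>t\<close>, serving as a Borel left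
  inverse of \<open>range_ind\<close> on strictly increasing functions. Past the end of a finite set
  the values are unspecified.\<close>

primrec enum :: "cantor \<Rightarrow> nat \<Rightarrow> nat" where
  "enum t 0 = (LEAST m. t m)"
| "enum t (Suc n) = (LEAST m. enum t n < m \<and> t m)"

lemma enum_range_ind:
  assumes f: "strict_mono f"
  shows "enum (range_ind f) = f"
proof
  have less: "f i < f j \<longleftrightarrow> i < j" and le: "f i \<le> f j \<longleftrightarrow> i \<le> j" for i j
    using f by (simp_all add: strict_mono_less strict_mono_less_eq)
  fix n show "enum (range_ind f) n = f n"
  proof (induction n)
    case 0
    show ?case unfolding enum.simps by (rule Least_equality) (auto simp: range_ind_def le)
  next
    case (Suc n)
    show ?case unfolding enum.simps Suc by (rule Least_equality) (auto simp: range_ind_def le less)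
  qed
qed

lemma range_ind_inject:
  assumes "strict_mono f" "strict_mono g"
  shows "range_ind f = range_ind g \<longleftrightarrow> f = g"
  using assms by (metis enum_range_ind)

lemma enum_measurable[measurable]: "enum \<in> borel_measurable borel"
proof (rule measurable_into_sequencesI)
  show "(\<lambda>t. enum t n) \<in> measurable borel (count_space UNIV)" for n
  proof (induction n)
    case (Suc n)
    note [measurable] = Suc
    show ?case unfolding enum.simps by measurable
  qed simp
qed

text \<open>The bound is the diagonal of the iterates of a monotone majorant of \<^term>\<open>\<phi>\<close>.\<close>

lemma range_ind_bounded_imp_dominated:
  "\<exists>g. \<forall>f. strict_mono f \<longrightarrow> (\<forall>\<^sub>F k in sequentially. \<exists>m\<in>{k..<\<phi> k}. range_ind f m) \<longrightarrow>
    (\<forall>\<^sub>F n in sequentially. f n \<le> g n)"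
proof -
  \<comment> \<open>Summing up to \<open>Suc k\<close> also bounds \<open>\<phi> (Suc k)\<close>,
    the value that matters when the search for the next element starts just after
    \<open>k\<close>.\<close>
  define \<psi> where "\<psi> k = (\<Sum>m\<le>Suc k. \<phi> m) + k" for k
  have \<psi>: "mono \<psi>" unfolding mono_def \<psi>_def by (intro allI impI add_mono sum_mono2) auto
  have \<psi>ge: "k \<le> \<psi> k" "\<phi> (Suc k) \<le> \<psi> k" for k
    by (auto simp: \<psi>_def intro: trans_le_add1)
  have mono_it: "(\<psi> ^^ i) a \<le> (\<psi> ^^ j) b" if "a \<le> b" "i \<le> j" for a b i j
  proof -
    have "(\<psi> ^^ i) a \<le> (\<psi> ^^ i) b" using \<psi> that(1) by (simp add: funpow_mono)
    also have "\<dots> \<le> (\<psi> ^^ j) b" using that(2)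
      by (induction rule: dec_induct) (auto intro: order_trans[OF _ \<psi>ge(1)])
    finally show ?thesis .
  qed
  show ?thesis
  proof (intro exI[of _ "\<lambda>n. (\<psi> ^^ n) n"] allI impI)
    fix f :: "nat \<Rightarrow> nat" assume f: "strict_mono f"
      and "\<forall>\<^sub>F k in sequentially. \<exists>m\<in>{k..<\<phi> k}. range_ind f m"
    then obtain N where N: "\<And>k. k \<ge> N \<Longrightarrow> \<exists>m\<in>{k..<\<phi> k}. m \<in> range f"
      unfolding eventually_sequentially range_ind_def by blast
    have step: "f (Suc n) \<le> \<psi> (f n)" if "n \<ge> N" for n
    proof -
      have "Suc (f n) \<ge> N" using strict_mono_imp_increasing[OF f, of n] that by simp
      then obtain l where l: "Suc (f n) \<le> f l" "f l < \<phi> (Suc (f n))" using N[of "Suc (f n)"] by auto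
      then have "n < l" using f by (simp add: Suc_le_eq strict_mono_less)
      then have "f (Suc n) \<le> f l" using f by (simp add: strict_mono_less_eq)
      then show ?thesis using l \<psi>ge(2)[of "f n"] by linarith
    qed
    have it: "f (N + i) \<le> (\<psi> ^^ i) (f N)" for i
    proof (induction i)
      case (Suc i)
      have "f (N + Suc i) \<le> \<psi> (f (N + i))" using step[of "N + i"] by simp
      also have "\<dots> \<le> \<psi> ((\<psi> ^^ i) (f N))" using Suc \<psi> by (simp add: monoD)
      finally show ?case by simp
    qed simp
    \<comment> \<open>From \<open>N + f N\<close> on, the diagonal has at least as many iterations
      and as large a starting point as the bound for \<open>f\<close>, which removes the dependence
      on \<open>N\<close> and \<open>f N\<close>.\<close>
    have "f n \<le> (\<psi> ^^ n) n" if "n \<ge> N + f N" for n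
    proof -
      have "f n \<le> (\<psi> ^^ (n - N)) (f N)" using it[of "n - N"] that by simp
      also have "\<dots> \<le> (\<psi> ^^ n) n" using that by (intro mono_it) auto
      finally show ?thesis .
    qed
    then show "\<forall>\<^sub>F n in sequentially. f n \<le> (\<psi> ^^ n) n" unfolding eventually_sequentially by blast
  qed
qed

text \<open>Moves the chain into the Cantor space: \<open>enum\<close> is Borel and recovers each
  \<open>f i\<close> from its range, so the preimage lemma applies.\<close>

lemma range_ind_dom_chain_universally_null:
  assumes r: "Well_order r"
    and chain: "\<And>i j. (j, i) \<in> r \<Longrightarrow> j \<noteq> i \<Longrightarrow> (f j, f i) \<in> dom_lt"
    and mono: "\<And>i. i \<in> Field r \<Longrightarrow> strict_mono (f i)"
  shows "universally_null ((\<lambda>i. range_ind (f i)) ` Field r)"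
proof (rule universally_null_vimage[of enum])
  have *: "enum ` (\<lambda>i. range_ind (f i)) ` Field r = f ` Field r"
    using mono by (auto simp: image_image enum_range_ind)
  show "universally_null (enum ` (\<lambda>i. range_ind (f i)) ` Field r)"
    unfolding * by (rule dom_chain_universally_null[OF r chain])
  fix y
  have "{x \<in> (\<lambda>i. range_ind (f i)) ` Field r. enum x = y} \<subseteq> {range_ind y}"
    using mono by (auto simp: enum_range_ind)
  then show "countable {x \<in> (\<lambda>i. range_ind (f i)) ` Field r. enum x = y}"
    by (rule countable_subset) simp
qed (rule enum_measurable)

section \<open>Universally null sets of size continuum\<close>

text \<open>A universal F-sigma set: for each \<open>n\<close>, the code \<open>c\<close> lists
  basic open sets whose union is the complement of the \<open>n\<close>-th closed set.\<close>

lemma fsigma_coding: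
  "\<exists>Fs :: cantor \<Rightarrow> cantor set. (\<forall>F. fsigma F \<longrightarrow> (\<exists>c. Fs c = F)) \<and>
     {(c, z). z \<in> Fs c} \<in> sets (borel \<Otimes>\<^sub>M borel)"
proof -
  obtain \<B> :: "cantor set set" where \<B>: "countable \<B>" "topological_basis \<B>"
    using ex_countable_basis by blast
  \<comment> \<open>The empty set guarantees that the enumerated family is nonempty.\<close>
  define B where "B = from_nat_into (insert {} \<B>)"
  have rB: "range B = insert {} \<B>"
    unfolding B_def using \<B>(1) by (intro range_from_nat_into) auto
  have oB[measurable]: "B s \<in> sets borel" for s
    using rB topological_basis_open[OF \<B>(2)] by (metis borel_open insertE open_empty rangeI)
  define Fs :: "cantor \<Rightarrow> cantor set" where
    "Fs c = {z. \<exists>n. \<forall>s. c (prod_encode (n, s)) \<longrightarrow> z \<notin> B s}" for c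
  have "\<exists>c. Fs c = F" if F: "fsigma F" for F
  proof -
    obtain C where C: "F = (\<Union>n::nat. C n)" "\<And>n. closed (C n)"
      using F by (auto elim!: fsigma.cases)
    \<comment> \<open>The largest possible code: all basic open sets that miss
      \<open>C n\<close>.\<close>
    define c where "c k \<longleftrightarrow> (case prod_decode k of (n, s) \<Rightarrow> B s \<inter> C n = {})" for k
    have "z \<in> C n \<longleftrightarrow> (\<forall>s. B s \<inter> C n = {} \<longrightarrow> z \<notin> B s)" for z n
    proof (intro iffI allI impI)
      assume *: "\<forall>s. B s \<inter> C n = {} \<longrightarrow> z \<notin> B s"
      show "z \<in> C n"
      proof (rule ccontr)
        assume "z \<notin> C n"
        then obtain U where "U \<in> \<B>" "z \<in> U" "U \<subseteq> - C n"
          using topological_basisE[OF \<B>(2), of "- C n" z] C(2) by auto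
        moreover obtain s where "B s = U" using rB \<open>U \<in> \<B>\<close> by (metis insertCI rangeE)
        ultimately show False using * by auto
      qed
    qed auto
    then have "Fs c = F" unfolding C(1) by (auto simp: Fs_def c_def)
    then show ?thesis by blast
  qed
  moreover have "{(c, z). z \<in> Fs c} \<in> sets (borel \<Otimes>\<^sub>M borel)"
  proof -
    have [measurable]: "Measurable.pred (borel \<Otimes>\<^sub>M borel) (\<lambda>x. (fst x :: cantor) n)" for n
      by (rule measurable_compose[OF measurable_fst measurable_coord])
    have "{(c, z). z \<in> Fs c} = {x \<in> space (borel \<Otimes>\<^sub>M borel). \<exists>n. \<forall>s. fst x (prod_encode (n, s)) \<longrightarrow> snd x \<notin> B s}"
      by (simp add: Fs_def space_pair_measure set_eq_iff split_beta)
    also have "\<dots> \<in> sets (borel \<Otimes>\<^sub>M borel)" by measurable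
    finally show ?thesis .
  qed
  ultimately show ?thesis by blast
qed

text \<open>Outer regularity is available for Polish spaces only, hence the detour through the embedding
  into \<^typ>\<open>nat \<Rightarrow> real\<close>.\<close>

lemma null_disjoint_fsigma:
  fixes N :: "cantor set"
  assumes \<rho>: "finite_nonatomic_borel_measure \<rho>" and N: "N \<in> null_sets \<rho>"
  shows "\<exists>F. fsigma F \<and> N \<inter> F = {} \<and> emeasure \<rho> (- F) = 0"
proof -
  note MD = finite_nonatomic_borel_measureD[OF \<rho>]
  interpret finite_measure \<rho> by (rule MD)
  have [measurable_cong]: "sets \<rho> = sets borel" by (rule MD)
  define e :: "cantor \<Rightarrow> nat \<Rightarrow> real" where "e c i = of_bool (c i)" for c i
  \<comment> \<open>A Borel left inverse of \<open>e\<close>; the preimage of \<open>N\<close> under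
    \<open>d\<close> is a Borel set that can stand in for the image of \<open>N\<close> under
    \<open>e\<close>.\<close>
  define d :: "(nat \<Rightarrow> real) \<Rightarrow> cantor" where "d f i \<longleftrightarrow> f i > 0" for f i
  have de: "d (e c) = c" for c by (simp add: d_def e_def fun_eq_iff)
  have ce: "continuous_on UNIV e"
  proof (rule continuous_on_coordinatewise_then_product)
    fix i
    have "continuous_on UNIV ((of_bool :: bool \<Rightarrow> real) \<circ> (\<lambda>c::cantor. c i))"
      by (intro continuous_on_compose continuous_on_product_coordinates Topological_Spaces.continuous_on_discrete)
    then show "continuous_on UNIV (\<lambda>c. e c i)" by (simp add: e_def o_def)
  qed
  have e[measurable]: "e \<in> borel_measurable borel" using ce by (rule borel_measurable_continuous_onI)
  have d[measurable]: "d \<in> borel_measurable borel"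
  proof (rule measurable_into_sequencesI)
    have [measurable]: "(\<lambda>f::nat \<Rightarrow> real. f n) \<in> borel_measurable borel" for n
      by (intro borel_measurable_continuous_onI continuous_on_product_coordinates)
    show "Measurable.pred borel (\<lambda>f. d f n)" for n unfolding d_def by measurable
  qed
  have Nb[measurable]: "N \<in> sets borel" using null_setsD2[OF N] by (simp add: MD)
  define D where "D = distr \<rho> borel e"
  interpret D: finite_measure D unfolding D_def by (rule finite_measure_distr) simp
  have N': "d -` N \<in> sets borel" using measurable_sets[OF d Nb] by simp
  have "emeasure D (d -` N) = emeasure \<rho> N"
    using N' unfolding D_def by (subst emeasure_distr) (auto simp: MD vimage_def de)
  then have "emeasure D (d -` N) = 0" using N by auto
  then have "(INF U\<in>{U. d -` N \<subseteq> U \<and> open U}. emeasure D U) = 0"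
    using outer_regular[of D "d -` N"] D.emeasure_finite[of "space D"] N' by (simp add: D_def)
  then have "\<exists>U. d -` N \<subseteq> U \<and> open U \<and> emeasure D U < \<epsilon>" if "\<epsilon> > 0" for \<epsilon>
    using that by (metis (no_types, lifting) INF_less_iff mem_Collect_eq)
  then have "\<exists>U. d -` N \<subseteq> U \<and> open U \<and> emeasure D U < ennreal (1 / Suc n)" for n
    by simp
  then obtain U where U: "\<And>n. d -` N \<subseteq> U n" "\<And>n. open (U n)" "\<And>n. emeasure D (U n) < ennreal (1 / Suc n)"
    by metis
  define F where "F = (\<Union>n. - (e -` U n))"
  have oe: "open (e -` U n)" for n using ce U(2) by (simp add: continuous_on_open_vimage)
  have "fsigma F" unfolding F_def by (rule fsigma.intros) (use oe in auto)
  moreover have "N \<inter> F = {}" using U(1) de by (auto simp: F_def)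
  moreover have le: "emeasure \<rho> (- F) \<le> ennreal (1 / Suc n)" for n
  proof -
    have "emeasure \<rho> (- F) \<le> emeasure \<rho> (e -` U n)"
      using oe[of n] by (intro emeasure_mono) (auto simp: F_def MD)
    also have "\<dots> = emeasure D (U n)"
      unfolding D_def using U(2) by (subst emeasure_distr) (auto simp: MD)
    finally show ?thesis using U(3)[of n] by simp
  qed
  have "emeasure \<rho> (- F) = 0"
  proof (rule ccontr)
    assume "emeasure \<rho> (- F) \<noteq> 0"
    then have "0 < measure \<rho> (- F)" by (simp add: emeasure_eq_measure zero_less_measure_iff)
    then obtain n where "1 / real (Suc n) < measure \<rho> (- F)"
      using reals_Archimedean by (auto simp: inverse_eq_divide)
    with le[of n] show False by (simp add: emeasure_eq_measure)
  qed
  ultimately show ?thesis by blast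
qed

text \<open>Lebesgue measure on the unit interval is carried over by sending a real to the set of
  rationals above it. This map is injective, so no atoms arise.\<close>

lemma exists_nonatomic_measure:
  "\<exists>\<rho> :: cantor measure. finite_nonatomic_borel_measure \<rho> \<and> emeasure \<rho> UNIV \<noteq> 0"
proof -
  define e :: "real \<Rightarrow> cantor" where "e x n \<longleftrightarrow> x < of_rat (from_nat n)" for x n
  have "inj e"
  proof (rule injI, rule ccontr)
    have "e x \<noteq> e y" if xy: "x < y" for x y
    proof -
      obtain q where q: "x < of_rat q" "of_rat q < y" using of_rat_dense[OF xy] by blast
      then have "e x (to_nat q) \<noteq> e y (to_nat q)" by (simp add: e_def)
      then show ?thesis by auto
    qed
    then show "e x = e y \<Longrightarrow> x \<noteq> y \<Longrightarrow> False" for x y by (metis linorder_neqE)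
  qed
  have e[measurable]: "e \<in> borel_measurable borel"
    unfolding e_def[abs_def] by (intro measurable_into_sequencesI) measurable
  define L :: "real measure" where "L = uniform_measure lborel {0..1}"
  interpret L: prob_space L unfolding L_def by (rule prob_space_uniform_measure) auto
  have [measurable_cong]: "sets L = sets borel" by (simp add: L_def)
  have spL: "space L = UNIV" by (simp add: L_def)
  define \<rho> where "\<rho> = distr L borel e"
  interpret \<rho>: prob_space \<rho> unfolding \<rho>_def by (rule L.prob_space_distr) simp
  have "emeasure \<rho> {x} = 0" for x
  proof -
    have "emeasure \<rho> {x} = emeasure L (e -` {x})"
      unfolding \<rho>_def by (subst emeasure_distr) (auto simp: spL singleton_in_sets_borel)
    also have "\<dots> = 0"
    proof -
      obtain y where "e -` {x} \<subseteq> {y}" using inj_vimage_singleton[OF \<open>inj e\<close>] by blast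
      then have "emeasure L (e -` {x}) \<le> emeasure L {y}" by (intro emeasure_mono) auto
      also have "\<dots> = 0" unfolding L_def by (subst emeasure_uniform_measure) (auto simp: Int_insert_right)
      finally show ?thesis by simp
    qed
    finally show ?thesis .
  qed
  moreover have "sets \<rho> = sets borel" "space \<rho> = UNIV" by (simp_all add: \<rho>_def)
  ultimately show ?thesis
    using \<rho>.emeasure_space_1 \<rho>.finite_measure_axioms
    by (intro exI[of _ \<rho>]) (auto simp: finite_nonatomic_borel_measure_def)
qed

lemma nonnull_meets_AE:
  assumes "finite_nonatomic_borel_measure \<rho>" "outer_measure_of \<rho> Z \<noteq> 0" "AE z in \<rho>. P z"
  shows "\<exists>z\<in>Z. P z"
proof (rule ccontr)
  note MD = finite_nonatomic_borel_measureD[OF assms(1)]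
  assume "\<not> (\<exists>z\<in>Z. P z)"
  moreover obtain N where "N \<in> null_sets \<rho>" "\<And>z. z \<notin> N \<Longrightarrow> P z"
    using assms(3) by (rule AE_E3) (auto simp: MD)
  ultimately have "Z \<subseteq> N" "N \<in> null_sets \<rho>" by blast+
  then show False using assms(2) outer_null_iff[of Z \<rho>] by (auto simp: MD)
qed

text \<open>Each \<open>x\<close> carries the code of a conull F-sigma set missing all points up to
  \<open>x\<close>. Given \<open>M\<close>, Fubini yields a \<open>z\<close> such that the
  \<open>g x\<close> whose coded set omits \<open>z\<close> form an \<open>M\<close>-null set. All
  \<open>x\<close> not before \<open>z\<close> are of this kind, and the others are fewer than
  continuum many.\<close>

theorem universally_null_of_size_continuum:
  assumes small: "\<And>X :: cantor set. |X| <o |UNIV :: cantor set| \<Longrightarrow> universally_null X"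
  shows "\<exists>X :: cantor set. universally_null X \<and> |X| =o |UNIV :: cantor set|"
proof -
  obtain \<rho> :: "cantor measure" where \<rho>: "finite_nonatomic_borel_measure \<rho>" "emeasure \<rho> UNIV \<noteq> 0"
    using exists_nonatomic_measure by blast
  note \<rho>D = finite_nonatomic_borel_measureD[OF \<rho>(1)]
  obtain Fs :: "cantor \<Rightarrow> cantor set" where Fs: "\<And>F. fsigma F \<Longrightarrow> \<exists>c. Fs c = F"
    and Fs_meas: "{(c, z). z \<in> Fs c} \<in> sets (borel \<Otimes>\<^sub>M borel)" using fsigma_coding by metis
  define r where "r = |UNIV :: cantor set|"
  have r: "Well_order r" "Card_order r" "Field r = UNIV"
    using card_of_Well_order[of "UNIV :: cantor set"] card_of_Card_order[of "UNIV :: cantor set"]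
    by (simp_all add: r_def Field_card_of)
  have smallS: "|underS r x| <o |UNIV :: cantor set|" for x
    using card_of_underS[OF r(2), of x] r(3) by (simp add: r_def)
  have "\<exists>c. under r x \<inter> Fs c = {} \<and> emeasure \<rho> (- Fs c) = 0" for x
  proof -
    have "outer_measure_of \<rho> (underS r x) = 0"
      using small[OF smallS[of x]] \<rho>(1) by (simp add: universally_null_def)
    then have "outer_measure_of \<rho> (underS r x \<union> {x}) = 0"
      by (rule outer_null_Un[rotated]) (auto simp: \<rho>D countable_outer_null[OF \<rho>(1)])
    then obtain N where N: "N \<in> null_sets \<rho>" "underS r x \<union> {x} \<subseteq> N"
      using outer_null_iff[of _ \<rho>] \<rho>D by auto
    have "under r x \<subseteq> underS r x \<union> {x}" by (auto simp: under_def underS_def)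
    then show ?thesis
      using null_disjoint_fsigma[OF \<rho>(1) N(1)] Fs N(2) by (metis disjoint_iff subset_iff)
  qed
  then obtain c where c: "\<And>x. under r x \<inter> Fs (c x) = {}" "\<And>x. emeasure \<rho> (- Fs (c x)) = 0" by metis
  \<comment> \<open>The even half makes the code a Borel function of the point; the odd half makes
    \<open>g\<close> injective.\<close>
  define g where "g x = interleave (c x) x" for x
  have "inj g" by (rule injI) (metis g_def odds_interleave)
  define R where "R = {(y, z). z \<notin> Fs (evens y)}"
  have Rb: "R \<in> sets (borel \<Otimes>\<^sub>M borel)"
  proof -
    have "R = space (borel \<Otimes>\<^sub>M borel) - ((\<lambda>(y, z). (evens y, z)) -` {(c, z). z \<in> Fs c} \<inter> space (borel \<Otimes>\<^sub>M borel))"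
      by (auto simp: R_def space_pair_measure)
    also have "\<dots> \<in> sets (borel \<Otimes>\<^sub>M borel)"
      by (intro sets.Diff sets.top measurable_sets[OF _ Fs_meas]) measurable
    finally show ?thesis .
  qed
  have "universally_null (range g)"
    unfolding universally_null_def
  proof (intro allI impI)
    fix M :: "cantor measure" assume M: "finite_nonatomic_borel_measure M"
    note MD = finite_nonatomic_borel_measureD[OF M]
    have sets_eq: "sets (M \<Otimes>\<^sub>M \<rho>) = sets (borel \<Otimes>\<^sub>M borel)"
      by (intro sets_pair_measure_cong MD \<rho>D)
    have "AE z in \<rho>. outer_measure_of M {y \<in> range g. (y, z) \<in> R} = 0"
    proof (rule AE_null_sections)
      fix y assume "y \<in> range g"
      then obtain x where "y = interleave (c x) x" by (auto simp: g_def)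
      then have "Pair y -` R = - Fs (c x)" by (auto simp: R_def)
      then show "emeasure \<rho> (Pair y -` R) = 0" using c by simp
    qed (use Rb sets_eq MD \<rho>D in \<open>auto intro: finite_measure.axioms\<close>)
    from nonnull_meets_AE[OF \<rho>(1) _ this, of UNIV]
    obtain z where z: "outer_measure_of M {y \<in> range g. (y, z) \<in> R} = 0"
      using \<rho>(2) \<rho>D by auto
    have 1: "outer_measure_of M (g ` underS r z) = 0"
    proof -
      have "|g ` underS r z| <o |UNIV :: cantor set|"
        using card_of_image smallS by (rule ordLeq_ordLess_trans)
      then show ?thesis using small M by (auto simp: universally_null_def)
    qed
    have "range g \<subseteq> {y \<in> range g. (y, z) \<in> R} \<union> g ` underS r z"
    proof clarify
      fix x assume x: "g x \<notin> g ` underS r z"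
      then have "x \<notin> underS r z" by auto
      then have "z \<in> under r x"
        using wo_rel.TOTALS[of r] wo_rel.REFL[of r] r unfolding wo_rel_def under_def underS_def refl_on_def by auto
      then have "z \<notin> Fs (c x)" using c by auto
      then show "g x \<in> range g \<and> (g x, z) \<in> R" by (simp add: R_def g_def)
    qed
    then show "outer_measure_of M (range g) = 0"
      by (rule outer_null_subset) (auto intro!: outer_null_Un z 1 simp: MD)
  qed
  moreover have "|range g| =o |UNIV :: cantor set|"
    using \<open>inj g\<close> by (meson card_of_ordIsoI inj_on_imp_bij_betw ordIso_symmetric)
  ultimately show ?thesis by blast
qed

section \<open>Universally null sets that are not countably perfectly null\<close>

definition prefix_code :: "cantor \<Rightarrow> nat \<Rightarrow> nat" where
  "prefix_code a n = to_nat (map a [0..<n])"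

lemma inj_prefix_code: "inj (prefix_code a)"
  by (rule injI) (metis diff_zero from_nat_to_nat length_map length_upt prefix_code_def)

text \<open>Joins all words whose codes lie in \<open>t\<close> without asking that they be
  consistent, so the map is total and visibly Borel.\<close>

definition prefix_decode :: "cantor \<Rightarrow> cantor" where
  "prefix_decode t k \<longleftrightarrow>
     (\<exists>m. t m \<and> k < length (from_nat m :: bool list) \<and> (from_nat m :: bool list) ! k)"

lemma prefix_decode_measurable[measurable]: "prefix_decode \<in> borel_measurable borel"
  unfolding prefix_decode_def[abs_def] by (intro measurable_into_sequencesI) measurable

text \<open>An infinite set of prefix codes of \<open>a\<close> contains the code of a prefix longer
  than any given \<open>k\<close>, and no word in it contradicts \<open>a\<close>.\<close>

lemma prefix_decode_range_ind:
  assumes f: "inj f" "range f \<subseteq> range (prefix_code a)"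
  shows "prefix_decode (range_ind f) = a"
proof
  fix k
  have "\<not> range f \<subseteq> prefix_code a ` {..k}"
    using range_inj_infinite[OF f(1)] finite_subset by blast
  then obtain m where m: "m \<in> range f" "m \<notin> prefix_code a ` {..k}" by blast
  then obtain l where "m = prefix_code a l" using f(2) by blast
  with m have l: "l > k" "prefix_code a l \<in> range f" by (auto simp: not_le[symmetric])
  show "prefix_decode (range_ind f) k = a k"
  proof
    assume "prefix_decode (range_ind f) k"
    then obtain m where m: "m \<in> range f" "k < length (from_nat m :: bool list)" "(from_nat m :: bool list) ! k"
      by (auto simp: prefix_decode_def range_ind_def)
    then obtain n where "m = prefix_code a n" using f(2) by blast
    with m show "a k" by (simp add: prefix_code_def)
  next
    assume "a k"
    then show "prefix_decode (range_ind f) k"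
      unfolding prefix_decode_def range_ind_def using l
      by (intro exI[of _ "prefix_code a l"]) (simp add: prefix_code_def)
  qed
qed

text \<open>The next element is always taken at or beyond \<open>\<phi> (Suc (f n))\<close>, so the
  interval starting at \<open>Suc (f n)\<close> is missed for every \<open>n\<close>.\<close>

lemma gappy_subsequence:
  fixes \<phi> :: "nat \<Rightarrow> nat"
  assumes P: "infinite P"
  shows "\<exists>f. strict_mono f \<and> range f \<subseteq> P \<and> \<not> (\<forall>\<^sub>F k in sequentially. \<exists>m\<in>{k..<\<phi> k}. range_ind f m)"
proof -
  have "\<exists>f. \<forall>n. f n \<in> P \<and> (f n < f (Suc n) \<and> \<phi> (Suc (f n)) \<le> f (Suc n))"
  proof (rule dependent_nat_choice)
    show "\<exists>x. x \<in> P" using P by (metis ex_in_conv finite.emptyI)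
    fix x n
    obtain y where "y \<in> P" "y > x + \<phi> (Suc x)" using P by (meson infinite_nat_iff_unbounded)
    then show "\<exists>y. y \<in> P \<and> x < y \<and> \<phi> (Suc x) \<le> y" by (intro exI[of _ y]) auto
  qed
  then obtain f where f: "\<And>n. f n \<in> P" "\<And>n. f n < f (Suc n)" "\<And>n. \<phi> (Suc (f n)) \<le> f (Suc n)" by blast
  have mono: "strict_mono f" using f(2) by (simp add: strict_mono_Suc_iff)
  have "\<not> (\<forall>\<^sub>F k in sequentially. \<exists>m\<in>{k..<\<phi> k}. range_ind f m)"
  proof
    assume "\<forall>\<^sub>F k in sequentially. \<exists>m\<in>{k..<\<phi> k}. range_ind f m"
    then obtain N where N: "\<And>k. k \<ge> N \<Longrightarrow> \<exists>m\<in>{k..<\<phi> k}. m \<in> range f"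
      by (auto simp: eventually_sequentially range_ind_def)
    have "Suc (f N) \<ge> N" using strict_mono_imp_increasing[OF mono, of N] by simp
    then obtain l where "Suc (f N) \<le> f l" "f l < \<phi> (Suc (f N))" using N[of "Suc (f N)"] by auto
    then have "f N < f l" "f l < f (Suc N)" using f(3)[of N] by auto
    then show False using mono by (simp add: strict_mono_less)
  qed
  then show ?thesis using mono f(1) by blast
qed

text \<open>The bijection \<open>g\<close> assigns every F-sigma code to some \<open>a\<close> in
  \<open>A\<close>, and \<open>y a\<close> is chosen outside that set if it is null. Since
  \<open>y a\<close> still decodes to \<open>a\<close>, the new set is universally null along with
  \<open>A\<close>.\<close>

lemma exists_not_countably_perfectly_null_if_size_continuum:
  fixes A :: "cantor set"
  assumes A: "universally_null A" and card: "|A| =o |UNIV :: cantor set|"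
  shows "\<exists>Y :: cantor set. universally_null Y \<and> \<not> countably_perfectly_null Y"
proof -
  obtain g where g: "bij_betw g A (UNIV :: cantor set)" using card card_of_ordIso by blast
  obtain Fs :: "cantor \<Rightarrow> cantor set" where Fs: "\<And>F. fsigma F \<Longrightarrow> \<exists>c. Fs c = F" using fsigma_coding by metis
  obtain \<rho> :: "cantor measure" where \<rho>: "finite_nonatomic_borel_measure \<rho>" "emeasure \<rho> UNIV \<noteq> 0"
    using exists_nonatomic_measure by blast
  obtain M where M: "finite_nonatomic_borel_measure M"
    and bnd: "\<And>F. fsigma F \<Longrightarrow> emeasure M F = 0 \<Longrightarrow>
      AE z in \<rho>. \<exists>\<phi>. \<forall>t. interleave z t \<in> F \<longrightarrow> (\<forall>\<^sub>F k in sequentially. \<exists>m\<in>{k..<\<phi> k}. t m)"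
    using exists_measure_bounding_sections[OF \<rho>(1)] by blast
  \<comment> \<open>Only the odd half is tied to \<open>a\<close>; the even half stays free to be a
    \<open>z\<close> whose section is bounded.\<close>
  define T where "T a = {y. \<exists>f. strict_mono f \<and> range f \<subseteq> range (prefix_code a) \<and> odds y = range_ind f}" for a
  have ex: "\<exists>y\<in>T a. fsigma F \<and> emeasure M F = 0 \<longrightarrow> y \<notin> F" for a F
  proof (cases "fsigma F \<and> emeasure M F = 0")
    case True
    obtain z \<phi> where z: "\<And>t. interleave z t \<in> F \<Longrightarrow> (\<forall>\<^sub>F k in sequentially. \<exists>m\<in>{k..<\<phi> k}. t m)"
      using nonnull_meets_AE[OF \<rho>(1) _ bnd, of UNIV F] True \<rho>(2) finite_nonatomic_borel_measureD[OF \<rho>(1)] by auto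
    obtain f where f: "strict_mono f" "range f \<subseteq> range (prefix_code a)"
        "\<not> (\<forall>\<^sub>F k in sequentially. \<exists>m\<in>{k..<\<phi> k}. range_ind f m)"
      using gappy_subsequence[of "range (prefix_code a)" \<phi>] range_inj_infinite[OF inj_prefix_code] by blast
    then have "interleave z (range_ind f) \<notin> F" using z by blast
    moreover have "interleave z (range_ind f) \<in> T a" using f by (auto simp: T_def)
    ultimately show ?thesis by blast
  next
    case False
    \<comment> \<open>There is nothing to escape here: the bound \<open>0\<close> and the even half
      are arbitrary.\<close>
    obtain f :: "nat \<Rightarrow> nat" where "strict_mono f" "range f \<subseteq> range (prefix_code a)"
      using gappy_subsequence[of "range (prefix_code a)" "\<lambda>_. 0"] range_inj_infinite[OF inj_prefix_code] by blast
    then have "interleave a (range_ind f) \<in> T a" by (auto simp: T_def)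
    then show ?thesis using False by blast
  qed
  then have "\<forall>a. \<exists>y. y \<in> T a \<and> (fsigma (Fs (g a)) \<and> emeasure M (Fs (g a)) = 0 \<longrightarrow> y \<notin> Fs (g a))" by blast
  then obtain y where y: "\<And>a. y a \<in> T a"
      "\<And>a. fsigma (Fs (g a)) \<Longrightarrow> emeasure M (Fs (g a)) = 0 \<Longrightarrow> y a \<notin> Fs (g a)"
    by metis
  have dec: "prefix_decode (odds (y a)) = a" for a
  proof -
    obtain f :: "nat \<Rightarrow> nat" where "strict_mono f" "range f \<subseteq> range (prefix_code a)" "odds (y a) = range_ind f"
      using y(1)[of a] by (auto simp: T_def)
    then show ?thesis by (simp add: prefix_decode_range_ind strict_mono_imp_inj_on)
  qed
  have "universally_null (y ` A)"
  proof (rule universally_null_vimage[of "\<lambda>x. prefix_decode (odds x)"])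
    show "universally_null ((\<lambda>x. prefix_decode (odds x)) ` y ` A)"
      using A by (simp add: image_image dec)
    fix b
    have "{x \<in> y ` A. prefix_decode (odds x) = b} \<subseteq> {y b}" by (auto simp: dec)
    then show "countable {x \<in> y ` A. prefix_decode (odds x) = b}" by (rule countable_subset) simp
  qed measurable
  moreover have "\<not> countably_perfectly_null (y ` A)"
  proof
    assume "countably_perfectly_null (y ` A)"
    then obtain F where F: "fsigma F" "y ` A \<subseteq> F" "emeasure M F = 0"
      using M by (auto simp: countably_perfectly_null_def)
    obtain c where "Fs c = F" using Fs[OF F(1)] by blast
    moreover obtain a where "a \<in> A" "g a = c" using g by (metis UNIV_I bij_betw_iff_bijections)
    ultimately show False using y(2)[of a] F by auto
  qed
  ultimately show ?thesis by blast
qed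

section \<open>Hypothesis (b): chains of length continuum and of length omega_1\<close>

lemma universally_null_of_size_continuum_if_bounded:
  assumes bnd: "\<And>W :: (nat \<Rightarrow> nat) set. |W| <o |UNIV :: cantor set| \<Longrightarrow>
    \<exists>g. \<forall>f\<in>W. \<forall>\<^sub>F n in sequentially. f n \<le> g n"
  shows "\<exists>X :: cantor set. universally_null X \<and> |X| =o |UNIV :: cantor set|"
proof -
  define r where "r = |UNIV :: cantor set|"
  have r: "Well_order r" "Card_order r" "Field r = UNIV"
    using card_of_Well_order[of "UNIV :: cantor set"] card_of_Card_order[of "UNIV :: cantor set"]
    by (simp_all add: r_def Field_card_of)
  have bnd': "\<exists>g. \<forall>j\<in>underS r i. \<forall>\<^sub>F n in sequentially. h j n \<le> g n" for i and h :: "cantor \<Rightarrow> nat \<Rightarrow> nat"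
  proof -
    have "|underS r i| <o |UNIV :: cantor set|" using card_of_underS[OF r(2), of i] r(3) by (simp add: r_def)
    then have "|h ` underS r i| <o |UNIV :: cantor set|" by (rule ordLeq_ordLess_trans[OF card_of_image])
    then show ?thesis using bnd[of "h ` underS r i"] by auto
  qed
  \<comment> \<open>Initial segments are smaller than the continuum, hence bounded; the zero
    functions impose no lower bound on the chain.\<close>
  obtain f where "\<forall>i. strict_mono (f i) \<and> (\<forall>j. (j, i) \<in> r \<longrightarrow> j \<noteq> i \<longrightarrow> (f j, f i) \<in> dom_lt)"
    using dom_chain_exists[OF r(1) bnd', of "\<lambda>_ _. 0"] unfolding r(3) by blast
  then have f: "\<And>i. strict_mono (f i)"
      "\<And>i j. (j, i) \<in> r \<Longrightarrow> j \<noteq> i \<Longrightarrow> (f j, f i) \<in> dom_lt" by blast+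
  have "inj f" using dom_chain_inj[where f = f, OF r(1) f(2)] unfolding r(3) .
  then have "inj (\<lambda>i. range_ind (f i))"
    using range_ind_inject[OF f(1) f(1)] by (auto simp: inj_def)
  then have "|range (\<lambda>i. range_ind (f i))| =o |UNIV :: cantor set|"
    by (meson card_of_ordIsoI inj_on_imp_bij_betw ordIso_symmetric)
  moreover have "universally_null (range (\<lambda>i. range_ind (f i)))"
    using range_ind_dom_chain_universally_null[where f = f, OF r(1) f(2,1)] unfolding r(3) .
  ultimately show ?thesis by blast
qed

text \<open>The odd halves form a chain and each has countably many partners, so \<open>Y\<close> is
  universally null. A null F-sigma cover would have a bounded section at some \<open>z j\<close>; it
  contains the codes of all \<open>f i\<close> with \<open>i\<close> from \<open>j\<close> on,
  earlier \<open>f i\<close> lie below \<open>f j\<close>, and so \<open>W\<close> would be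
  bounded.\<close>

lemma exists_not_countably_perfectly_null_if_size_aleph1:
  fixes Z :: "cantor set" and W :: "(nat \<Rightarrow> nat) set"
  assumes Z: "\<not> universally_null Z" "|Z| \<le>o cardSuc natLeq"
    and W: "\<not> (\<exists>g. \<forall>f\<in>W. \<forall>\<^sub>F n in sequentially. f n \<le> g n)" "|W| \<le>o cardSuc natLeq"
  shows "\<exists>Y :: cantor set. universally_null Y \<and> \<not> countably_perfectly_null Y"
proof -
  define r where "r = cardSuc natLeq"
  have co: "Card_order r" unfolding r_def by (rule cardSuc_Card_order[OF natLeq_Card_order])
  then have wo: "Well_order r" by (rule card_order_on_well_order_on)
  obtain \<rho> :: "cantor measure" where \<rho>: "finite_nonatomic_borel_measure \<rho>" "outer_measure_of \<rho> Z \<noteq> 0"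
    using Z(1) by (auto simp: universally_null_def)
  have "Z \<noteq> {}" using \<rho> countable_outer_null[OF \<rho>(1), of "{}"] by auto
  have "W \<noteq> {}" using W(1) by auto
  have Fr: "|Field r| =o r" using co by (rule card_of_Field_ordIso)
  have "|Z| \<le>o |Field r|" "|W| \<le>o |Field r|"
    using Z(2) W(2) ordLeq_ordIso_trans[OF _ ordIso_symmetric[OF Fr]] by (auto simp: r_def)
  \<comment> \<open>Enumerations along omega_1, possibly with repetitions.\<close>
  then obtain z w where z: "z ` Field r = Z" and w: "w ` Field r = W"
    using card_of_ordLeq2[OF \<open>Z \<noteq> {}\<close>, of "Field r"] card_of_ordLeq2[OF \<open>W \<noteq> {}\<close>, of "Field r"] by blast
  have cnt: "countable (underS r i)" if "i \<in> Field r" for i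
  proof -
    have "|underS r i| \<le>o natLeq"
      using card_of_underS[OF co that] cardSuc_ordLeq_ordLess[OF natLeq_Card_order card_of_Card_order]
      unfolding r_def by blast
    then have "|underS r i| \<le>o |UNIV :: nat set|"
      using ordIso_symmetric[OF card_of_nat] by (rule ordLeq_ordIso_trans)
    then show ?thesis by (simp add: countable_def card_of_ordLeq[symmetric])
  qed
  obtain f where f: "\<And>i. i \<in> Field r \<Longrightarrow> strict_mono (f i)" "\<And>i n. i \<in> Field r \<Longrightarrow> w i n \<le> f i n"
      "\<And>i j. (j, i) \<in> r \<Longrightarrow> j \<noteq> i \<Longrightarrow> (f j, f i) \<in> dom_lt"
  proof -
    have "\<exists>f. \<forall>i\<in>Field r. strict_mono (f i) \<and> (\<forall>n. w i n \<le> f i n) \<and>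
        (\<forall>j. (j, i) \<in> r \<longrightarrow> j \<noteq> i \<longrightarrow> (f j, f i) \<in> dom_lt)"
      by (rule dom_chain_exists[OF wo]) (rule countable_family_bounded[OF cnt])
    then show ?thesis using that by (metis FieldI2)
  qed
  \<comment> \<open>Taking \<open>j\<close> up to \<open>i\<close> keeps the fibres over
    \<open>f i\<close> countable, while every \<open>z j\<close> still meets a final segment of the
    chain.\<close>
  define Y where "Y = {interleave (z j) (range_ind (f i)) | i j. (j, i) \<in> r}"
  have "universally_null Y"
  proof (rule universally_null_vimage[of "\<lambda>y. odds y"])
    have "(\<lambda>i. range_ind (f i)) ` Field r = odds ` Y"
      using wo_rel.REFL[of r] wo unfolding wo_rel_def refl_on_def
      by (force simp: Y_def image_iff intro: FieldI2)
    moreover have "universally_null ((\<lambda>i. range_ind (f i)) ` Field r)"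
      by (rule range_ind_dom_chain_universally_null[OF wo]) (use f in auto)
    ultimately show "universally_null (odds ` Y)" by simp
    fix b
    have "inj_on f (Field r)" using dom_chain_inj[OF wo] f(3) by blast
    then have inj: "inj_on (\<lambda>i. range_ind (f i)) (Field r)"
      using range_ind_inject f(1) by (auto simp: inj_on_def)
    show "countable {y \<in> Y. odds y = b}"
    proof (cases "\<exists>i\<in>Field r. b = range_ind (f i)")
      case True
      then obtain i where i: "i \<in> Field r" "b = range_ind (f i)" by blast
      have "{y \<in> Y. odds y = b} \<subseteq> (\<lambda>j. interleave (z j) b) ` (insert i (underS r i))"
      proof clarify
        fix y assume "y \<in> Y" "b = odds y"
        then obtain i' j where y: "y = interleave (z j) (range_ind (f i'))" "(j, i') \<in> r" "b = range_ind (f i')"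
          by (auto simp: Y_def)
        then have "i' = i" using inj i by (auto simp: inj_on_def dest: FieldI2)
        then show "y \<in> (\<lambda>j. interleave (z j) (odds y)) ` insert i (underS r i)"
          using y by (auto simp: underS_def image_iff)
      qed
      then show ?thesis by (rule countable_subset) (use cnt i in auto)
    next
      case False
      then have "{y \<in> Y. odds y = b} = {}" by (auto simp: Y_def dest: FieldI2)
      then show ?thesis by (simp only: countable_empty)
    qed
  qed measurable
  moreover have "\<not> countably_perfectly_null Y"
  proof
    assume cpn: "countably_perfectly_null Y"
    obtain M where M: "finite_nonatomic_borel_measure M"
      and bnd: "\<And>F. fsigma F \<Longrightarrow> emeasure M F = 0 \<Longrightarrow>
        AE z in \<rho>. \<exists>\<phi>. \<forall>t. interleave z t \<in> F \<longrightarrow> (\<forall>\<^sub>F k in sequentially. \<exists>m\<in>{k..<\<phi> k}. t m)"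
      using exists_measure_bounding_sections[OF \<rho>(1)] by blast
    obtain F where F: "fsigma F" "Y \<subseteq> F" "emeasure M F = 0"
      using M cpn by (auto simp: countably_perfectly_null_def)
    obtain j \<phi> where j: "j \<in> Field r"
      and \<phi>: "\<And>t. interleave (z j) t \<in> F \<Longrightarrow> (\<forall>\<^sub>F k in sequentially. \<exists>m\<in>{k..<\<phi> k}. t m)"
      using nonnull_meets_AE[OF \<rho> bnd[OF F(1,3)]] z by blast
    obtain g where g: "\<And>f. strict_mono f \<Longrightarrow> (\<forall>\<^sub>F k in sequentially. \<exists>m\<in>{k..<\<phi> k}. range_ind f m) \<Longrightarrow>
        (\<forall>\<^sub>F n in sequentially. f n \<le> g n)"
      using range_ind_bounded_imp_dominated[of \<phi>] by blast
    have above: "\<forall>\<^sub>F n in sequentially. f i n \<le> g n" if "(j, i) \<in> r" for i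
      using that F(2) f(1) by (intro g \<phi>) (auto simp: Y_def dest: FieldI2)
    have refl: "(j, j) \<in> r" using wo_rel.REFL[of r] wo j unfolding wo_rel_def refl_on_def by blast
    have "\<forall>\<^sub>F n in sequentially. w i n \<le> g n" if i: "i \<in> Field r" for i
    proof -
      have "(j, i) \<in> r \<or> (i, j) \<in> r \<and> i \<noteq> j"
        using wo_rel.TOTALS[of r] wo i j refl unfolding wo_rel_def by blast
      then have "\<forall>\<^sub>F n in sequentially. f i n \<le> g n"
      proof
        assume "(i, j) \<in> r \<and> i \<noteq> j"
        then have "\<forall>\<^sub>F n in sequentially. f i n < f j n" using f(3) by (auto simp: dom_lt_def)
        with above[OF refl] show ?thesis by eventually_elim simp
      qed (rule above)
      then show ?thesis
      proof (rule eventually_mono)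
        show "w i n \<le> g n" if "f i n \<le> g n" for n using that f(2)[OF i, of n] by simp
      qed
    qed
    then show False using W(1) w by blast
  qed
  ultimately show ?thesis by blast
qed

lemma continuum_ordIso: "continuum =o |UNIV :: cantor set|"
proof -
  have "Func (UNIV :: nat set) (UNIV :: bool set) = UNIV" by (auto simp: Func_def)
  then have "continuum = |UNIV :: cantor set|"
    by (simp add: continuum_def cexp_def ctwo_def Field_card_of Field_natLeq)
  then show ?thesis by (metis card_of_refl)
qed

theorem theorem3p2:
  assumes "(\<exists>A :: cantor set. universally_null A \<and> |A| =o continuum) \<or> continuum \<le>o aleph2"
  shows "\<exists>A :: cantor set. universally_null A \<and> \<not> countably_perfectly_null A"
proof (cases "\<exists>A :: cantor set. universally_null A \<and> |A| =o |UNIV :: cantor set|")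
  case True
  then show ?thesis using exists_not_countably_perfectly_null_if_size_continuum by blast
next
  case False
  then have "continuum \<le>o aleph2" using assms ordIso_transitive[OF _ continuum_ordIso] by blast
  then have c: "|UNIV :: cantor set| \<le>o cardSuc (cardSuc natLeq)"
    using ordIso_ordLeq_trans[OF ordIso_symmetric[OF continuum_ordIso]] by (simp add: aleph2_def)
  \<comment> \<open>Hypothesis (b) enters here: a cardinal below aleph_2 is at most aleph_1.\<close>
  have le: "|S| \<le>o cardSuc natLeq" if "|S| <o |UNIV :: cantor set|" for S :: "'s set"
    using ordLess_ordLeq_trans[OF that c]
      cardSuc_ordLeq_ordLess[OF cardSuc_Card_order[OF natLeq_Card_order] card_of_Card_order] by blast
  \<comment> \<open>Both constructions of a universally null set of size continuum must fail here;
    their failure supplies the non-null set and the unbounded family.\<close>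
  obtain Z :: "cantor set" where Z: "\<not> universally_null Z" "|Z| <o |UNIV :: cantor set|"
    using False universally_null_of_size_continuum by blast
  obtain W :: "(nat \<Rightarrow> nat) set" where W: "|W| <o |UNIV :: cantor set|"
      "\<not> (\<exists>g. \<forall>f\<in>W. \<forall>\<^sub>F n in sequentially. f n \<le> g n)"
    using False universally_null_of_size_continuum_if_bounded by blast
  show ?thesis by (rule exists_not_countably_perfectly_null_if_size_aleph1[OF Z(1) le[OF Z(2)] W(2) le[OF W(1)]])
qed

end
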